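(* Let $G$ be an arbitrary graph with vertex set $\{1,\dots,n\}$, $n>3$. Let $H$ be a fixed but arbitrary graph (possibly with self-loops) with $q$ vertices, and let $\mathcal{M}_{\mathrm{Gl}}$ and $\mathcal{M}_{\rightarrow}$ be the Glauber dynamics and the systematic scan, respectively, applied to $H$-colorings of $G$. Then $$\lambda(\mathcal{M}_{\rightarrow})\ \le\ n^2\,q\,\lambda(\mathcal{M}_{\mathrm{Gl}}).$$
   Context: $G$ and $H$ are finite undirected graphs. An $H$-coloring of $G$ is a graph homomorphism from $G$ to $H$, i.e. a map $\sigma:V(G)\to V(H)$ such that $\sigma_i\sigma_j$ is an edge of $H$ (possibly a loop) whenever $ij$ is an edge of $G$. The state space $\Omega$ is the set of $H$-colorings of $G$, and $\pi$ is the uniform distribution on $\Omega$, which is stationary for both chains. The procedure Metropolis($v$): choose a color $c\in V(H)$ uniformly at random and propose recoloring $v$ with $c$; the proposal is accepted if and only if every neighbor $w$ of $v$ in $G$ is colored with a neighbor (in $H$) of $c$; otherwise the coloring is unchanged. One step of $\mathcal{M}_{\mathrm{Gl}}$: choose a vertex $v$ of $G$ uniformly at random and do Metropolis($v$). One step of $\mathcal{M}_{\rightarrow}$: for $v=1,2,\dots,n$ in this order, do Metropolis($v$) (with independent color choices). For a Markov chain $\mathcal{M}$ with transition matrix $P$, stationary distribution $\pi$ and state space $\Omega$, the optimal Poincaré constant is $$\lambda(\mathcal{M})=\inf_{f:\Omega\to\mathbb{R}}\frac{\mathcal{E}_{\mathcal{M}}(f,f)}{\mathrm{var}_\pi(f)},$$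 the infimum over nonconstant $f$, where $\mathcal{E}_{\mathcal{M}}(f,f)=\frac12\sum_{x,y\in\Omega}\pi(x)P(x,y)(f(x)-f(y))^2$ and $\mathrm{var}_\pi(f)=\sum_{x\in\Omega}\pi(x)(f(x)-\mathbf{E}_\pi f)^2$. *)

theory Defs
  imports "HOL-Probability.Probability" "Graph_Theory.Pair_Digraph"
begin

text \<open>
  A finite undirected graph is a finite digraph with a symmetric arc set: the locale
  \<open>pair_pseudo_graph\<close> if self-loops are allowed, \<open>pair_graph\<close> if they are not.
\<close>

text \<open>Colorings are extensional (\<open>undefined\<close> off the vertex set), so that two
  colorings are equal iff they agree on the vertices.\<close>

definition colorings :: "'v pair_pre_digraph \<Rightarrow> 'c pair_pre_digraph \<Rightarrow> ('v \<Rightarrow> 'c) set" where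
  "colorings G H =
     {\<sigma> \<in> pverts G \<rightarrow>\<^sub>E pverts H. \<forall>(i, j) \<in> parcs G. (\<sigma> i, \<sigma> j) \<in> parcs H}"

definition metropolis ::
  "'v pair_pre_digraph \<Rightarrow> 'c pair_pre_digraph \<Rightarrow> 'v \<Rightarrow> ('v \<Rightarrow> 'c) \<Rightarrow> ('v \<Rightarrow> 'c) pmf" where
  "metropolis G H v \<sigma> =
     map_pmf (\<lambda>c. if \<forall>w. (v, w) \<in> parcs G \<longrightarrow> (c, \<sigma> w) \<in> parcs H then \<sigma>(v := c) else \<sigma>)
       (pmf_of_set (pverts H))"

definition glauber_step ::
  "'v pair_pre_digraph \<Rightarrow> 'c pair_pre_digraph \<Rightarrow> ('v \<Rightarrow> 'c) \<Rightarrow> ('v \<Rightarrow> 'c) pmf" where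
  "glauber_step G H \<sigma> = bind_pmf (pmf_of_set (pverts G)) (\<lambda>v. metropolis G H v \<sigma>)"

text \<open>The vertices of the list are updated from left to right.\<close>

primrec scan_list ::
  "'v pair_pre_digraph \<Rightarrow> 'c pair_pre_digraph \<Rightarrow> 'v list \<Rightarrow> ('v \<Rightarrow> 'c) \<Rightarrow> ('v \<Rightarrow> 'c) pmf" where
  "scan_list G H [] \<sigma> = return_pmf \<sigma>"
| "scan_list G H (v # vs) \<sigma> = bind_pmf (metropolis G H v \<sigma>) (scan_list G H vs)"

definition scan_step ::
  "nat pair_pre_digraph \<Rightarrow> 'c pair_pre_digraph \<Rightarrow> (nat \<Rightarrow> 'c) \<Rightarrow> (nat \<Rightarrow> 'c) pmf" where
  "scan_step G H = scan_list G H (sorted_list_of_set (pverts G))"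

definition dirichlet_form ::
  "'s set \<Rightarrow> ('s \<Rightarrow> 's pmf) \<Rightarrow> 's pmf \<Rightarrow> ('s \<Rightarrow> real) \<Rightarrow> real" where
  "dirichlet_form \<Omega> K \<pi> f =
     1 / 2 * (\<Sum>x\<in>\<Omega>. \<Sum>y\<in>\<Omega>. pmf \<pi> x * pmf (K x) y * (f x - f y)\<^sup>2)"

definition variance_on :: "'s set \<Rightarrow> 's pmf \<Rightarrow> ('s \<Rightarrow> real) \<Rightarrow> real" where
  "variance_on \<Omega> \<pi> f = (\<Sum>x\<in>\<Omega>. pmf \<pi> x * (f x - measure_pmf.expectation \<pi> f)\<^sup>2)"

text \<open>
  The infimum is taken in the extended reals, so that it is \<open>\<infinity>\<close> when the state space has at
  most one element and hence no nonconstant function exists. Only the values of \<open>f\<close>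
  on \<open>\<Omega>\<close> matter, provided that \<open>\<pi>\<close> is supported on \<open>\<Omega>\<close>.
\<close>

definition poincare_const :: "'s set \<Rightarrow> ('s \<Rightarrow> 's pmf) \<Rightarrow> 's pmf \<Rightarrow> ereal" where
  "poincare_const \<Omega> K \<pi> =
     (INF f \<in> {f :: 's \<Rightarrow> real. \<not> f constant_on \<Omega>}.
        ereal (dirichlet_form \<Omega> K \<pi> f / variance_on \<Omega> \<pi> f))"

text \<open>If there are no colorings at all, \<open>pmf_of_set\<close> is unspecified, but then the infimum
  below is over the empty set and does not depend on it.\<close>

definition lambda_glauber :: "'v pair_pre_digraph \<Rightarrow> 'c pair_pre_digraph \<Rightarrow> ereal" where
  "lambda_glauber G H =
     poincare_const (colorings G H) (glauber_step G H) (pmf_of_set (colorings G H))"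

definition lambda_scan :: "nat pair_pre_digraph \<Rightarrow> 'c pair_pre_digraph \<Rightarrow> ereal" where
  "lambda_scan G H =
     poincare_const (colorings G H) (scan_step G H) (pmf_of_set (colorings G H))"

end

theory Submission
  imports Defs
begin

text \<open>
  The inequality already holds between the Dirichlet forms, function by function. Run a scan
  \<open>X\<^sub>0, X\<^sub>1, \<dots>, X\<^sub>n\<close> from a uniformly random coloring \<open>X\<^sub>0\<close>, where \<open>X\<^sub>v\<close> is the coloring after
  vertex \<open>v\<close> has been updated. A single Metropolis update has a symmetric transition matrix
  (\<open>pmf_metropolis_commute\<close>), so every \<open>X\<^sub>v\<close> is again uniform. Telescoping \<open>f X\<^sub>0 - f X\<^sub>n\<close> and
  applying Cauchy--Schwarz to the \<open>n\<close> increments bounds the Dirichlet form of the scan by \<open>n\<close>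
  times the sum of the Dirichlet forms of the single updates (\<open>dirichlet_form_scan_list_le\<close>).
  Glauber dynamics is the average of the same updates, so this sum is \<open>n\<close> times its Dirichlet
  form. This gives a factor \<open>n\<^sup>2\<close>, which is at most \<open>n\<^sup>2 q\<close> because \<open>q \<ge> 1\<close>. Dividing by the
  variance, which is the same for both chains, and taking infima gives the claim.
\<close>

section \<open>Dirichlet forms of composed chains\<close>

lemma dirichlet_form_nonneg: "0 \<le> dirichlet_form \<Omega> K \<pi> f"
  unfolding dirichlet_form_def by (intro mult_nonneg_nonneg sum_nonneg) auto

lemma variance_on_nonneg: "0 \<le> variance_on \<Omega> \<pi> f"
  unfolding variance_on_def by (intro sum_nonneg) auto

lemma pmf_bind_finite:
  assumes "finite \<Omega>" "set_pmf M \<subseteq> \<Omega>"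
  shows "pmf (bind_pmf M N) z = (\<Sum>y\<in>\<Omega>. pmf M y * pmf (N y) z)"
  unfolding pmf_bind
  by (subst integral_measure_pmf[of \<Omega>]) (use assms in auto)

text \<open>Cauchy--Schwarz for two terms, with the weights that make the induction over the number of
  steps give exactly the number of steps as constant.\<close>

lemma square_add_le_weighted:
  fixes a b m :: real
  assumes "0 < m"
  shows "(a + b)\<^sup>2 \<le> (m + 1) * (a\<^sup>2 + b\<^sup>2 / m)"
proof -
  have "(m + 1) * (a\<^sup>2 + b\<^sup>2 / m) - (a + b)\<^sup>2 = (m * a - b)\<^sup>2 / m"
    using assms by (simp add: field_simps power2_eq_square)
  also have "0 \<le> (m * a - b)\<^sup>2 / m" using assms by simp
  finally show ?thesis by simp
qed

text \<open>The two steps of a composed chain start from \<open>\<pi>\<close> each, because \<open>K\<close> preserves \<open>\<pi>\<close>;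
  the increment of \<open>f\<close> over both is split by the weighted inequality above.\<close>

lemma dirichlet_form_bind_le:
  fixes m :: real
  assumes fin: "finite \<Omega>"
    and K: "\<And>x. x \<in> \<Omega> \<Longrightarrow> set_pmf (K x) \<subseteq> \<Omega>"
    and L: "\<And>x. x \<in> \<Omega> \<Longrightarrow> set_pmf (L x) \<subseteq> \<Omega>"
    and stationary: "\<And>y. y \<in> \<Omega> \<Longrightarrow> (\<Sum>x\<in>\<Omega>. pmf \<pi> x * pmf (K x) y) = pmf \<pi> y"
    and m: "0 < m"
  shows "dirichlet_form \<Omega> (\<lambda>x. bind_pmf (K x) L) \<pi> f
      \<le> (m + 1) * (dirichlet_form \<Omega> K \<pi> f + dirichlet_form \<Omega> L \<pi> f / m)"
proof -
  let ?w = "\<lambda>x y z. pmf \<pi> x * pmf (K x) y * pmf (L y) z"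
  have "(\<Sum>x\<in>\<Omega>. \<Sum>z\<in>\<Omega>. pmf \<pi> x * pmf (bind_pmf (K x) L) z * (f x - f z)\<^sup>2)
      = (\<Sum>x\<in>\<Omega>. \<Sum>z\<in>\<Omega>. \<Sum>y\<in>\<Omega>. ?w x y z * (f x - f z)\<^sup>2)"
    by (intro sum.cong refl)
      (simp add: pmf_bind_finite[OF fin K] sum_distrib_left sum_distrib_right mult_ac)
  also have "\<dots> \<le> (\<Sum>x\<in>\<Omega>. \<Sum>z\<in>\<Omega>. \<Sum>y\<in>\<Omega>.
      ?w x y z * ((m + 1) * ((f x - f y)\<^sup>2 + (f y - f z)\<^sup>2 / m)))"
    using square_add_le_weighted[OF m, of "f x - f y" "f y - f z" for x y z]
    by (intro sum_mono mult_left_mono) auto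
  also have "\<dots> = (m + 1) * ((\<Sum>x\<in>\<Omega>. \<Sum>z\<in>\<Omega>. \<Sum>y\<in>\<Omega>. ?w x y z * (f x - f y)\<^sup>2)
      + (\<Sum>x\<in>\<Omega>. \<Sum>z\<in>\<Omega>. \<Sum>y\<in>\<Omega>. ?w x y z * (f y - f z)\<^sup>2) / m)"
    by (simp add: sum.distrib sum_distrib_left sum_divide_distrib algebra_simps)
  also have "(\<Sum>x\<in>\<Omega>. \<Sum>z\<in>\<Omega>. \<Sum>y\<in>\<Omega>. ?w x y z * (f x - f y)\<^sup>2)
      = (\<Sum>x\<in>\<Omega>. \<Sum>y\<in>\<Omega>. pmf \<pi> x * pmf (K x) y * (f x - f y)\<^sup>2)"
  proof (rule sum.cong[OF refl])
    fix x
    have "(\<Sum>z\<in>\<Omega>. \<Sum>y\<in>\<Omega>. ?w x y z * (f x - f y)\<^sup>2)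
        = (\<Sum>y\<in>\<Omega>. \<Sum>z\<in>\<Omega>. ?w x y z * (f x - f y)\<^sup>2)"
      by (rule sum.swap)
    also have "\<dots> = (\<Sum>y\<in>\<Omega>. pmf \<pi> x * pmf (K x) y * (f x - f y)\<^sup>2 * (\<Sum>z\<in>\<Omega>. pmf (L y) z))"
      unfolding sum_distrib_left by (simp only: mult_ac)
    also have "\<dots> = (\<Sum>y\<in>\<Omega>. pmf \<pi> x * pmf (K x) y * (f x - f y)\<^sup>2)"
      by (intro sum.cong refl) (simp add: sum_pmf_eq_1[OF fin L])
    finally show "(\<Sum>z\<in>\<Omega>. \<Sum>y\<in>\<Omega>. ?w x y z * (f x - f y)\<^sup>2)
        = (\<Sum>y\<in>\<Omega>. pmf \<pi> x * pmf (K x) y * (f x - f y)\<^sup>2)" .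
  qed
  also have "(\<Sum>x\<in>\<Omega>. \<Sum>z\<in>\<Omega>. \<Sum>y\<in>\<Omega>. ?w x y z * (f y - f z)\<^sup>2)
      = (\<Sum>y\<in>\<Omega>. \<Sum>z\<in>\<Omega>. pmf \<pi> y * pmf (L y) z * (f y - f z)\<^sup>2)"
  proof -
    have "(\<Sum>x\<in>\<Omega>. \<Sum>z\<in>\<Omega>. \<Sum>y\<in>\<Omega>. ?w x y z * (f y - f z)\<^sup>2)
        = (\<Sum>x\<in>\<Omega>. \<Sum>y\<in>\<Omega>. \<Sum>z\<in>\<Omega>. ?w x y z * (f y - f z)\<^sup>2)"
      by (intro sum.cong refl sum.swap)
    also have "\<dots> = (\<Sum>y\<in>\<Omega>. \<Sum>x\<in>\<Omega>. \<Sum>z\<in>\<Omega>. ?w x y z * (f y - f z)\<^sup>2)"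
      by (rule sum.swap)
    also have "\<dots> = (\<Sum>y\<in>\<Omega>. \<Sum>z\<in>\<Omega>. \<Sum>x\<in>\<Omega>. ?w x y z * (f y - f z)\<^sup>2)"
      by (intro sum.cong refl sum.swap)
    also have "\<dots> = (\<Sum>y\<in>\<Omega>. \<Sum>z\<in>\<Omega>.
        (\<Sum>x\<in>\<Omega>. pmf \<pi> x * pmf (K x) y) * pmf (L y) z * (f y - f z)\<^sup>2)"
      by (simp add: sum_distrib_right)
    also have "\<dots> = (\<Sum>y\<in>\<Omega>. \<Sum>z\<in>\<Omega>. pmf \<pi> y * pmf (L y) z * (f y - f z)\<^sup>2)"
      by (simp add: stationary)
    finally show ?thesis .
  qed
  finally have bound: "(\<Sum>x\<in>\<Omega>. \<Sum>z\<in>\<Omega>. pmf \<pi> x * pmf (bind_pmf (K x) L) z * (f x - f z)\<^sup>2)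
      \<le> (m + 1) * ((\<Sum>x\<in>\<Omega>. \<Sum>y\<in>\<Omega>. pmf \<pi> x * pmf (K x) y * (f x - f y)\<^sup>2)
        + (\<Sum>y\<in>\<Omega>. \<Sum>z\<in>\<Omega>. pmf \<pi> y * pmf (L y) z * (f y - f z)\<^sup>2) / m)" .
  have half: "1 / 2 * X \<le> (m + 1) * (1 / 2 * A + 1 / 2 * B / m)"
    if "X \<le> (m + 1) * (A + B / m)" for X A B :: real
  proof -
    have eq: "(m + 1) * (1 / 2 * A + 1 / 2 * B / m) = 1 / 2 * ((m + 1) * (A + B / m))"
      by (simp add: algebra_simps)
    show ?thesis unfolding eq using that by (intro mult_left_mono) auto
  qed
  show ?thesis
    unfolding dirichlet_form_def by (rule half[OF bound])
qed

section \<open>A single Metropolis update\<close>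

lemma finite_colorings:
  assumes "finite (pverts G)" "finite (pverts H)"
  shows "finite (colorings G H)"
  by (rule finite_subset[of _ "pverts G \<rightarrow>\<^sub>E pverts H"])
    (auto simp: colorings_def intro: finite_PiE assms)

lemma set_pmf_metropolis:
  assumes G: "pair_graph G" and H: "pair_pseudo_graph H" "pverts H \<noteq> {}"
    and v: "v \<in> pverts G" and \<sigma>: "\<sigma> \<in> colorings G H"
  shows "set_pmf (metropolis G H v \<sigma>) \<subseteq> colorings G H"
proof -
  interpret G: pair_graph G by (rule G)
  interpret H: pair_pseudo_graph H by (rule H)
  have upd: "\<sigma>(v := c) \<in> colorings G H"
    if c: "c \<in> pverts H" and acc: "\<forall>w. (v, w) \<in> parcs G \<longrightarrow> (c, \<sigma> w) \<in> parcs H" for c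
  proof -
    have "((\<sigma>(v := c)) i, (\<sigma>(v := c)) j) \<in> parcs H" if ij: "(i, j) \<in> parcs G" for i j
    proof -
      have "(j, i) \<in> parcs G" using G.arcs_symmetric[OF ij] .
      moreover have "i \<noteq> j" using G.no_loops[of "(i, j)"] ij by auto
      moreover have "(\<sigma> i, \<sigma> j) \<in> parcs H" using \<sigma> ij by (auto simp: colorings_def)
      ultimately show ?thesis using acc ij by (auto intro: H.arcs_symmetric)
    qed
    moreover have "\<sigma>(v := c) \<in> pverts G \<rightarrow>\<^sub>E pverts H"
      using \<sigma> v c by (auto simp: colorings_def PiE_iff extensional_def)
    ultimately show ?thesis by (auto simp: colorings_def simp del: fun_upd_apply)
  qed
  show ?thesis
    using upd \<sigma> H.finite_verts H(2) by (auto simp: metropolis_def)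
qed

text \<open>The only color that leads from \<open>\<sigma>\<close> to a different coloring \<open>\<tau>\<close> is \<open>\<tau> v\<close>. It leads there
  iff the two agree off \<open>v\<close>: since \<open>\<tau>\<close> is itself a coloring and \<open>v\<close> is not its own neighbor,
  the proposal is then accepted.\<close>

lemma pmf_metropolis_neq:
  assumes G: "pair_graph G" and H: "pair_pseudo_graph H" "pverts H \<noteq> {}"
    and v: "v \<in> pverts G" and \<tau>: "\<tau> \<in> colorings G H" and neq: "\<sigma> \<noteq> \<tau>"
  shows "pmf (metropolis G H v \<sigma>) \<tau>
      = (if \<forall>w. w \<noteq> v \<longrightarrow> \<sigma> w = \<tau> w then 1 / real (card (pverts H)) else 0)"
proof -
  interpret G: pair_graph G by (rule G)
  interpret H: pair_pseudo_graph H by (rule H)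
  let ?step = "\<lambda>c. if \<forall>w. (v, w) \<in> parcs G \<longrightarrow> (c, \<sigma> w) \<in> parcs H then \<sigma>(v := c) else \<sigma>"
  have prob: "pmf (metropolis G H v \<sigma>) \<tau>
      = real (card (pverts H \<inter> ?step -` {\<tau>})) / real (card (pverts H))"
    unfolding metropolis_def pmf_map using H.finite_verts H(2)
    by (subst measure_pmf_of_set) auto
  show ?thesis
  proof (cases "\<forall>w. w \<noteq> v \<longrightarrow> \<sigma> w = \<tau> w")
    case True
    have \<tau>_eq: "\<tau> = \<sigma>(v := \<tau> v)" using True by auto
    have "\<forall>w. (v, w) \<in> parcs G \<longrightarrow> (\<tau> v, \<sigma> w) \<in> parcs H"
    proof (intro allI impI)
      fix w assume vw: "(v, w) \<in> parcs G"
      then have "w \<noteq> v" using G.no_loops[of "(v, w)"] by auto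
      with True have "\<sigma> w = \<tau> w" by blast
      then show "(\<tau> v, \<sigma> w) \<in> parcs H" using \<tau> vw by (auto simp: colorings_def)
    qed
    then have "?step (\<tau> v) = \<tau>" using \<tau>_eq by simp
    moreover have "c = \<tau> v" if "?step c = \<tau>" for c
      using that neq by (auto split: if_splits)
    moreover have "\<tau> v \<in> pverts H" using \<tau> v by (auto simp: colorings_def)
    ultimately have "pverts H \<inter> ?step -` {\<tau>} = {\<tau> v}" by blast
    with True prob show ?thesis by simp
  next
    case False
    then obtain w where "w \<noteq> v" "\<sigma> w \<noteq> \<tau> w" by blast
    then have "?step c w \<noteq> \<tau> w" for c by simp
    then have empty: "pverts H \<inter> ?step -` {\<tau>} = {}" by blast
    show ?thesis unfolding prob empty if_not_P[OF False] by simp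
  qed
qed

lemma pmf_metropolis_commute:
  assumes "pair_graph G" "pair_pseudo_graph H" "pverts H \<noteq> {}" "v \<in> pverts G"
    and "\<sigma> \<in> colorings G H" "\<tau> \<in> colorings G H"
  shows "pmf (metropolis G H v \<sigma>) \<tau> = pmf (metropolis G H v \<tau>) \<sigma>"
proof (cases "\<sigma> = \<tau>")
  case False
  then show ?thesis
    using assms by (simp add: pmf_metropolis_neq eq_commute[of "\<tau> _"])
qed simp

lemma metropolis_stationary:
  assumes G: "pair_graph G" and H: "pair_pseudo_graph H" "pverts H \<noteq> {}"
    and v: "v \<in> pverts G" and \<tau>: "\<tau> \<in> colorings G H"
  shows "(\<Sum>\<sigma>\<in>colorings G H. pmf (pmf_of_set (colorings G H)) \<sigma> * pmf (metropolis G H v \<sigma>) \<tau>)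
      = pmf (pmf_of_set (colorings G H)) \<tau>"
proof -
  interpret G: pair_graph G by (rule G)
  interpret H: pair_pseudo_graph H by (rule H)
  let ?\<Omega> = "colorings G H"
  have fin: "finite ?\<Omega>" by (intro finite_colorings G.finite_verts H.finite_verts)
  have ne: "?\<Omega> \<noteq> {}" using \<tau> by auto
  have "(\<Sum>\<sigma>\<in>?\<Omega>. pmf (pmf_of_set ?\<Omega>) \<sigma> * pmf (metropolis G H v \<sigma>) \<tau>)
      = pmf (pmf_of_set ?\<Omega>) \<tau> * (\<Sum>\<sigma>\<in>?\<Omega>. pmf (metropolis G H v \<sigma>) \<tau>)"
    using fin ne \<tau> by (simp add: sum_distrib_left)
  also have "(\<Sum>\<sigma>\<in>?\<Omega>. pmf (metropolis G H v \<sigma>) \<tau>) = (\<Sum>\<sigma>\<in>?\<Omega>. pmf (metropolis G H v \<tau>) \<sigma>)"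
    using assms by (intro sum.cong refl pmf_metropolis_commute) auto
  also have "\<dots> = 1"
    by (rule sum_pmf_eq_1[OF fin set_pmf_metropolis[OF G H v \<tau>]])
  finally show ?thesis by simp
qed

section \<open>Systematic scan\<close>

lemma set_pmf_scan_list:
  assumes "pair_graph G" "pair_pseudo_graph H" "pverts H \<noteq> {}" "set vs \<subseteq> pverts G"
    and "\<sigma> \<in> colorings G H"
  shows "set_pmf (scan_list G H vs \<sigma>) \<subseteq> colorings G H"
  using assms(4,5)
proof (induction vs arbitrary: \<sigma>)
  case (Cons v vs)
  then show ?case
    using set_pmf_metropolis[OF assms(1-3), of v \<sigma>] by fastforce
qed simp

text \<open>Telescoping over the updates of the scan and Cauchy--Schwarz, done one update at a time.\<close>

lemma dirichlet_form_scan_list_le: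
  assumes G: "pair_graph G" and H: "pair_pseudo_graph H" "pverts H \<noteq> {}"
    and vs: "set vs \<subseteq> pverts G"
  defines "\<Omega> \<equiv> colorings G H"
  shows "dirichlet_form \<Omega> (scan_list G H vs) (pmf_of_set \<Omega>) f
      \<le> real (length vs) * (\<Sum>v\<leftarrow>vs. dirichlet_form \<Omega> (metropolis G H v) (pmf_of_set \<Omega>) f)"
  using vs
proof (induction vs)
  case Nil
  have no_move: "p * pmf (return_pmf x) y * (f x - f y)\<^sup>2 = 0" for p x y
    by (cases "x = y") auto
  show ?case unfolding dirichlet_form_def scan_list.simps no_move by simp
next
  case (Cons v vs)
  interpret G: pair_graph G by (rule G)
  interpret H: pair_pseudo_graph H by (rule H)
  let ?D = "\<lambda>K. dirichlet_form \<Omega> K (pmf_of_set \<Omega>) f"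
  show ?case
  proof (cases "vs = []")
    case True
    have "scan_list G H [] = return_pmf" by (rule ext) simp
    then have "scan_list G H [v] = metropolis G H v"
      by (intro ext) (simp add: bind_return_pmf')
    then show ?thesis using True by simp
  next
    case False
    let ?m = "real (length vs)"
    have m: "0 < ?m" using False by simp
    have scan: "scan_list G H (v # vs) = (\<lambda>\<sigma>. bind_pmf (metropolis G H v \<sigma>) (scan_list G H vs))"
      by (rule ext) simp
    have "?D (scan_list G H (v # vs))
        \<le> (?m + 1) * (?D (metropolis G H v) + ?D (scan_list G H vs) / ?m)"
      unfolding scan
    proof (rule dirichlet_form_bind_le[OF _ _ _ _ m])
      show "finite \<Omega>"
        unfolding \<Omega>_def by (intro finite_colorings G.finite_verts H.finite_verts)
      have v: "v \<in> pverts G" and vs: "set vs \<subseteq> pverts G" using Cons.prems by auto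
      show "set_pmf (metropolis G H v x) \<subseteq> \<Omega>" if "x \<in> \<Omega>" for x
        using set_pmf_metropolis[OF G H v] that by (simp add: \<Omega>_def)
      show "set_pmf (scan_list G H vs x) \<subseteq> \<Omega>" if "x \<in> \<Omega>" for x
        using set_pmf_scan_list[OF G H vs] that by (simp add: \<Omega>_def)
      show "(\<Sum>x\<in>\<Omega>. pmf (pmf_of_set \<Omega>) x * pmf (metropolis G H v x) y) = pmf (pmf_of_set \<Omega>) y"
        if "y \<in> \<Omega>" for y
        using metropolis_stationary[OF G H v] that by (simp add: \<Omega>_def)
    qed
    also have "\<dots> \<le> (?m + 1) * (?D (metropolis G H v) + (\<Sum>v\<leftarrow>vs. ?D (metropolis G H v)))"
      using Cons m by (intro mult_left_mono add_left_mono) (auto simp: divide_le_eq mult.commute)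
    finally show ?thesis by (simp add: add.commute del: scan_list.simps)
  qed
qed

section \<open>Comparison with Glauber dynamics\<close>

lemma dirichlet_form_glauber_step:
  assumes "finite (pverts G)" "pverts G \<noteq> {}"
  shows "real (card (pverts G)) * dirichlet_form \<Omega> (glauber_step G H) \<pi> f
      = (\<Sum>v\<in>pverts G. dirichlet_form \<Omega> (metropolis G H v) \<pi> f)"
proof -
  let ?V = "pverts G"
  let ?t = "\<lambda>v x y. pmf \<pi> x * pmf (metropolis G H v x) y * (f x - f y)\<^sup>2"
  have card: "real (card ?V) \<noteq> 0" using assms by simp
  have "real (card ?V) * (pmf \<pi> x * pmf (glauber_step G H x) y * (f x - f y)\<^sup>2)
      = (\<Sum>v\<in>?V. ?t v x y)" for x y
  proof -
    have "real (card ?V) * pmf (glauber_step G H x) y = (\<Sum>v\<in>?V. pmf (metropolis G H v x) y)"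
      using card by (simp add: glauber_step_def pmf_bind_pmf_of_set[OF assms(2,1)])
    then have "real (card ?V) * (pmf \<pi> x * pmf (glauber_step G H x) y * (f x - f y)\<^sup>2)
        = pmf \<pi> x * (\<Sum>v\<in>?V. pmf (metropolis G H v x) y) * (f x - f y)\<^sup>2"
      by simp
    then show ?thesis by (simp add: sum_distrib_left sum_distrib_right)
  qed
  then have "real (card ?V) * dirichlet_form \<Omega> (glauber_step G H) \<pi> f
      = 1 / 2 * (\<Sum>x\<in>\<Omega>. \<Sum>y\<in>\<Omega>. \<Sum>v\<in>?V. ?t v x y)"
    by (simp add: dirichlet_form_def sum_distrib_left sum_divide_distrib)
  also have "(\<Sum>x\<in>\<Omega>. \<Sum>y\<in>\<Omega>. \<Sum>v\<in>?V. ?t v x y) = (\<Sum>x\<in>\<Omega>. \<Sum>v\<in>?V. \<Sum>y\<in>\<Omega>. ?t v x y)"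
    by (intro sum.cong refl sum.swap)
  also have "\<dots> = (\<Sum>v\<in>?V. \<Sum>x\<in>\<Omega>. \<Sum>y\<in>\<Omega>. ?t v x y)"
    by (rule sum.swap)
  finally show ?thesis by (simp add: dirichlet_form_def sum_distrib_left sum_divide_distrib)
qed

theorem dirichlet_form_scan_le_glauber:
  assumes G: "pair_graph G" and H: "pair_pseudo_graph H" "pverts H \<noteq> {}"
  defines "\<Omega> \<equiv> colorings G H"
  shows "dirichlet_form \<Omega> (scan_step G H) (pmf_of_set \<Omega>) f
      \<le> (real (card (pverts G)))\<^sup>2 * dirichlet_form \<Omega> (glauber_step G H) (pmf_of_set \<Omega>) f"
proof -
  interpret G: pair_graph G by (rule G)
  let ?D = "\<lambda>K. dirichlet_form \<Omega> K (pmf_of_set \<Omega>) f"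
  let ?vs = "sorted_list_of_set (pverts G)"
  have "?D (scan_step G H) \<le> real (card (pverts G)) * (\<Sum>v\<leftarrow>?vs. ?D (metropolis G H v))"
    using dirichlet_form_scan_list_le[OF G H, of ?vs f]
    by (simp add: scan_step_def \<Omega>_def)
  also have "(\<Sum>v\<leftarrow>?vs. ?D (metropolis G H v)) = (\<Sum>v\<in>pverts G. ?D (metropolis G H v))"
    by (simp add: sum_list_distinct_conv_sum_set)
  also have "\<dots> = real (card (pverts G)) * ?D (glauber_step G H)"
    by (cases "pverts G = {}") (simp_all add: dirichlet_form_glauber_step)
  finally show ?thesis by (simp add: power2_eq_square mult.assoc)
qed

text \<open>Multiplication by \<open>c\<close> is moved to the other side as a division, so that the infimum
  can be bounded below one function at a time; this also covers an infinite constant.\<close>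

lemma poincare_const_le_mult:
  assumes c: "0 < c"
    and le: "\<And>f. dirichlet_form \<Omega> K \<pi> f \<le> c * dirichlet_form \<Omega> L \<pi> f"
  shows "poincare_const \<Omega> K \<pi> \<le> ereal c * poincare_const \<Omega> L \<pi>"
proof -
  have "poincare_const \<Omega> K \<pi> / ereal c \<le> poincare_const \<Omega> L \<pi>"
    unfolding poincare_const_def[of \<Omega> L]
  proof (rule INF_greatest)
    fix f :: "'a \<Rightarrow> real"
    assume f: "f \<in> {f. \<not> f constant_on \<Omega>}"
    have "poincare_const \<Omega> K \<pi> \<le> ereal (dirichlet_form \<Omega> K \<pi> f / variance_on \<Omega> \<pi> f)"
      unfolding poincare_const_def using f by (rule INF_lower)
    also have "\<dots> \<le> ereal c * ereal (dirichlet_form \<Omega> L \<pi> f / variance_on \<Omega> \<pi> f)"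
      using divide_right_mono[OF le variance_on_nonneg] by simp
    finally show "poincare_const \<Omega> K \<pi> / ereal c
        \<le> ereal (dirichlet_form \<Omega> L \<pi> f / variance_on \<Omega> \<pi> f)"
      using c by (subst ereal_divide_le_pos) auto
  qed
  then show ?thesis using c by (subst (asm) ereal_divide_le_pos) auto
qed

theorem theorem32:
  fixes G :: "nat pair_pre_digraph" and H :: "'c pair_pre_digraph" and n q :: nat
  assumes "pair_graph G" and "pverts G = {1..n}" and "n > 3"
    and "pair_pseudo_graph H" and "pverts H \<noteq> {}" and "card (pverts H) = q"
  shows "lambda_scan G H \<le> ereal (real n ^ 2 * real q) * lambda_glauber G H"
proof -
  interpret H: pair_pseudo_graph H by fact
  let ?\<Omega> = "colorings G H"
  let ?D = "\<lambda>K f. dirichlet_form ?\<Omega> K (pmf_of_set ?\<Omega>) f"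
  have q: "q \<ge> 1"
    using assms(5,6) H.finite_verts by (auto simp: Suc_le_eq card_gt_0_iff)
  have "?D (scan_step G H) f \<le> real n ^ 2 * real q * ?D (glauber_step G H) f" for f
  proof -
    have "?D (scan_step G H) f \<le> (real n)\<^sup>2 * ?D (glauber_step G H) f"
      using dirichlet_form_scan_le_glauber[OF assms(1,4,5), of f] assms(2) by simp
    also have "\<dots> \<le> real n ^ 2 * real q * ?D (glauber_step G H) f"
      using q dirichlet_form_nonneg
      by (intro mult_right_mono) (auto simp: mult_le_cancel_left1)
    finally show ?thesis .
  qed
  then show ?thesis
    unfolding lambda_scan_def lambda_glauber_def
    using assms(3) q by (intro poincare_const_le_mult) auto
qed

end
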